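(* Let $\mathcal K$ be a collection of kernels with $|\mathcal K|<\infty$, and assume $(A_0)$, $(A_1)$, $(A_2)$, $(A_3)$ as listed in the context (for every $K\in\mathcal K$). Let $\Lambda=\{2^i\lambda_L:i=0,1,\dots,b\}$ with $\lambda_L>0$, $b\in\mathbb N$. Let $0<\alpha\le1$, $0<\tilde w<w<\frac12$, and $$B\ge\frac{|\Lambda|^2|\mathcal K|^2}{2\tilde w^2\alpha^2}\log\frac{2|\Lambda||\mathcal K|}{\alpha(1-w-\tilde w)}.$$ Then, under $H_0:P=Q$, $$P_{H_0}\left(\bigcup_{(\lambda,K)\in\Lambda\times\mathcal K}\left\{\hat\eta^{(K)}_{\lambda,l}\ge\hat q^{B,\lambda,l}_{1-\frac{w\alpha}{|\Lambda||\mathcal K|},K}\right\}\right)\le\alpha,$$ i.e. this union is a level-$\alpha$ critical region for testing $H_0:P=Q$ against $H_1:P\ne Q$.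
   Context: Setting. $\mathcal X$ is a second countable topological space with its Borel $\sigma$-algebra; $P,Q$ are Borel probability measures on $\mathcal X$. Assumptions. For every $K\in\mathcal K$: $(A_0)$ $K$ is a continuous reproducing kernel of an RKHS of real-valued functions on $\mathcal X$ with $\sup_x K(x,x)\le\kappa$. $(A_1)$ $K(x,y)=\int_\Theta\varphi(x,\vartheta)\varphi(y,\vartheta)\,d\Xi(\vartheta)$, where $\varphi=\varphi_K:\mathcal X\times\Theta\to\mathbb R$ is continuous, $\sup_{\vartheta,x}|\varphi(x,\vartheta)|\le\sqrt\kappa$, and $\Xi=\Xi_K$ is a Borel probability measure on a second countable space $\Theta$. For each $\lambda>0$, $g_\lambda:[0,\infty)\to[0,\infty)$ satisfies, with $\Gamma=[0,\kappa]$ and finite positive constants $C_1,C_2$ independent of $\lambda$: $(A_2)$ $\sup_{x\in\Gamma}|xg_\lambda(x)|\le C_1$; $(A_3)$ $\sup_{x\in\Gamma}|\lambda g_\lambda(x)|\le C_2$. Functional calculus. For a compact self-adjoint positive operator $\mathcal M=\sum_i\tau_i\psi_i\otimes\psi_i$ (orthonormal $\psi_i$), $h(\mathcal M)=\sum_i h(\tau_i)\psi_i\otimes\psi_i+h(0)(I-\sum_i\psi_i\otimes\psi_i)$; $g_\lambda^{1/2}$ is the pointwise square root. Random features. For each $K\in\mathcal K$, $\vartheta_1,\dots,\vartheta_l$ are i.i.d. from $\Xi_K$; $K_l(x,y)=\frac1l\sum_{i=1}^l\varphi_K(x,\vartheta_i)\varphi_K(y,\vartheta_i)$, with RKHS $\mathcal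 H_l$. Test statistic. $X_1,\dots,X_N$ i.i.d. $\sim P$ and $Y_1,\dots,Y_M$ i.i.d. $\sim Q$ are independent of each other and of the random features. With $s\ge2$, $n=N-s\ge2$, $m=M-s\ge2$, $X_i^1=X_{N-s+i}$, $Y_i^1=Y_{M-s+i}$ ($1\le i\le s$), let $Z_i=X_i^1$ if $\alpha_i=1$ and $Z_i=Y_i^1$ if $\alpha_i=0$, with $\alpha_i$ i.i.d. Bernoulli$(1/2)$ independent of everything else. For each $K\in\mathcal K$ let $$\hat\Sigma_{PQ,l}=\frac{1}{2s(s-1)}\sum_{i\ne j}^{s}(K_l(\cdot,Z_i)-K_l(\cdot,Z_j))\otimes_{\mathcal H_l}(K_l(\cdot,Z_i)-K_l(\cdot,Z_j)),$$ $$\hat\eta^{(K)}_{\lambda,l}=\frac{1}{n(n-1)m(m-1)}\sum_{1\le i\ne j\le n}\ \sum_{1\le i'\ne j'\le m}\left\langle g_\lambda^{1/2}(\hat\Sigma_{PQ,l})(K_l(\cdot,X_i)-K_l(\cdot,Y_{i'})),\,g_\lambda^{1/2}(\hat\Sigma_{PQ,l})(K_l(\cdot,X_j)-K_l(\cdot,Y_{j'}))\right\rangle_{\mathcal H_l}.$$ Permutation quantile. Put $U_i=X_i$ ($1\le i\le n$), $U_{n+j}=Y_j$ ($1\le j\le m$). For a permutation $\pi$ of $\{1,\dots,n+m\}$ let $\hat\eta^{(K),\pi}_{\lambda,l}$ be $\hat\eta^{(K)}_{\lambda,l}$ computed with $(X_i)_{i\le n}$, $(Y_j)_{j\le m}$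 replaced by $(U_{\pi(i)})_{i\le n}$, $(U_{\pi(n+j)})_{j\le m}$ (same $Z_i$ and random features). Let $\pi^1,\dots,\pi^B$ be permutations drawn independently and uniformly at random, independent of the data, and $$\hat q^{B,\lambda,l}_{1-a,K}=\inf\left\{q\in\mathbb R:\frac1B\sum_{i=1}^B\mathbf 1(\hat\eta^{(K),\pi^i}_{\lambda,l}\le q)\ge1-a\right\}.$$ $P_{H_0}$ is the probability, when $P=Q$, over all of this randomness.
   Formalization: The rejection event is proved with strict inequality (statistic > permutation quantile) instead of ≥; with ≥ the claim fails, e.g. for the constant kernel K=1, where the statistic always equals the quantile and the union has probability 1. *)

theory Defs
  imports "HOL-Probability.Probability"
begin

definition borel_of :: "'a topology \<Rightarrow> 'a measure" where
  "borel_of T = sigma (topspace T) {U. openin T U}"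

section \<open>Reproducing kernel Hilbert spaces of real functions\<close>

text \<open>The inner product is only meaningful on the carrier.\<close>

record 'x fspace =
  fcarrier :: "('x \<Rightarrow> real) set"
  finner :: "('x \<Rightarrow> real) \<Rightarrow> ('x \<Rightarrow> real) \<Rightarrow> real"

definition fnorm :: "'x fspace \<Rightarrow> ('x \<Rightarrow> real) \<Rightarrow> real" where
  "fnorm H f = sqrt (finner H f f)"

definition hilbert_fspace :: "'x fspace \<Rightarrow> bool" where
  "hilbert_fspace H \<longleftrightarrow>
     (\<lambda>_. 0) \<in> fcarrier H \<and>
     (\<forall>f\<in>fcarrier H. \<forall>h\<in>fcarrier H. (\<lambda>x. f x + h x) \<in> fcarrier H) \<and>
     (\<forall>a. \<forall>f\<in>fcarrier H. (\<lambda>x. a * f x) \<in> fcarrier H) \<and>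
     (\<forall>f\<in>fcarrier H. \<forall>h\<in>fcarrier H. finner H f h = finner H h f) \<and>
     (\<forall>f\<in>fcarrier H. \<forall>h\<in>fcarrier H. \<forall>k\<in>fcarrier H.
        finner H (\<lambda>x. f x + h x) k = finner H f k + finner H h k) \<and>
     (\<forall>a. \<forall>f\<in>fcarrier H. \<forall>h\<in>fcarrier H. finner H (\<lambda>x. a * f x) h = a * finner H f h) \<and>
     (\<forall>f\<in>fcarrier H. 0 \<le> finner H f f \<and> (finner H f f = 0 \<longrightarrow> f = (\<lambda>_. 0))) \<and>
     (\<forall>F :: nat \<Rightarrow> 'x \<Rightarrow> real.
        (\<forall>i. F i \<in> fcarrier H) \<and>
        (\<forall>e>0. \<exists>n0. \<forall>i\<ge>n0. \<forall>j\<ge>n0. fnorm H (\<lambda>x. F i x - F j x) < e) \<longrightarrow>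
        (\<exists>f\<in>fcarrier H. (\<lambda>i. fnorm H (\<lambda>x. F i x - f x)) \<longlonglongrightarrow> 0))"

definition is_rkhs :: "'x fspace \<Rightarrow> ('x \<Rightarrow> 'x \<Rightarrow> real) \<Rightarrow> bool" where
  "is_rkhs H K \<longleftrightarrow> hilbert_fspace H \<and>
     (\<forall>x. (\<lambda>u. K u x) \<in> fcarrier H \<and> (\<forall>f\<in>fcarrier H. f x = finner H f (\<lambda>u. K u x)))"

text \<open>By Moore--Aronszajn the carrier, and the inner product on it, are uniquely determined
  by the kernel; the choice only concerns values of the inner product outside the carrier.\<close>

definition rkhs_of :: "('x \<Rightarrow> 'x \<Rightarrow> real) \<Rightarrow> 'x fspace" where
  "rkhs_of K = (SOME H. is_rkhs H K)"

section \<open>Functional calculus\<close>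

definition has_fsum :: "'x fspace \<Rightarrow> ('i \<Rightarrow> 'x \<Rightarrow> real) \<Rightarrow> 'i set \<Rightarrow> ('x \<Rightarrow> real) \<Rightarrow> bool" where
  "has_fsum H u I f \<longleftrightarrow> f \<in> fcarrier H \<and>
     ((\<lambda>F. fnorm H (\<lambda>x. (\<Sum>i\<in>F. u i x) - f x)) \<longlongrightarrow> 0) (finite_subsets_at_top I)"

definition fsum :: "'x fspace \<Rightarrow> ('i \<Rightarrow> 'x \<Rightarrow> real) \<Rightarrow> 'i set \<Rightarrow> 'x \<Rightarrow> real" where
  "fsum H u I = (SOME f. has_fsum H u I f)"

definition ftensor ::
  "'x fspace \<Rightarrow> ('x \<Rightarrow> real) \<Rightarrow> ('x \<Rightarrow> real) \<Rightarrow> ('x \<Rightarrow> real) \<Rightarrow> 'x \<Rightarrow> real" where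
  "ftensor H a b f = (\<lambda>x. finner H b f * a x)"

definition spectral_decomposition ::
  "'x fspace \<Rightarrow> (('x \<Rightarrow> real) \<Rightarrow> 'x \<Rightarrow> real) \<Rightarrow>
   nat set \<Rightarrow> (nat \<Rightarrow> real) \<Rightarrow> (nat \<Rightarrow> 'x \<Rightarrow> real) \<Rightarrow> bool" where
  "spectral_decomposition H A I \<tau> \<psi> \<longleftrightarrow>
     (\<forall>i\<in>I. \<psi> i \<in> fcarrier H \<and> 0 \<le> \<tau> i) \<and>
     (\<forall>i\<in>I. \<forall>j\<in>I. finner H (\<psi> i) (\<psi> j) = (if i = j then 1 else 0)) \<and>
     (\<forall>f\<in>fcarrier H. has_fsum H (\<lambda>i x. \<tau> i * ftensor H (\<psi> i) (\<psi> i) f x) I (A f))"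

text \<open>The result does not depend on which spectral decomposition is chosen.\<close>

definition fun_calculus ::
  "'x fspace \<Rightarrow> (real \<Rightarrow> real) \<Rightarrow> (('x \<Rightarrow> real) \<Rightarrow> 'x \<Rightarrow> real) \<Rightarrow>
   ('x \<Rightarrow> real) \<Rightarrow> 'x \<Rightarrow> real" where
  "fun_calculus H h A f =
     (let (I, \<tau>, \<psi>) = (SOME (I, \<tau>, \<psi>). spectral_decomposition H A I \<tau> \<psi>)
      in (\<lambda>x. fsum H (\<lambda>i x. h (\<tau> i) * ftensor H (\<psi> i) (\<psi> i) f x) I x
             + h 0 * (f x - fsum H (\<lambda>i x. ftensor H (\<psi> i) (\<psi> i) f x) I x)))"

section \<open>The test statistic\<close>

definition rf_kernel :: "('x \<Rightarrow> 't \<Rightarrow> real) \<Rightarrow> nat \<Rightarrow> (nat \<Rightarrow> 't) \<Rightarrow> 'x \<Rightarrow> 'x \<Rightarrow> real" where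
  "rf_kernel \<phi> l t x y = 1 / real l * (\<Sum>i\<in>{1..l}. \<phi> x (t i) * \<phi> y (t i))"

definition cov_op ::
  "('x \<Rightarrow> 'x \<Rightarrow> real) \<Rightarrow> nat \<Rightarrow> (nat \<Rightarrow> 'x) \<Rightarrow> ('x \<Rightarrow> real) \<Rightarrow> 'x \<Rightarrow> real" where
  "cov_op k s z f = (\<lambda>x. 1 / (2 * real s * (real s - 1)) *
     (\<Sum>i\<in>{1..s}. \<Sum>j\<in>{1..s} - {i}.
        ftensor (rkhs_of k) (\<lambda>u. k u (z i) - k u (z j)) (\<lambda>u. k u (z i) - k u (z j)) f x))"

text \<open>Here \<open>h\<close> stands for \<open>g\<^sub>\<lambda>\<close>, \<open>z\<close> for the sample used in the covariance operator, and
  \<open>x 1, \<dots>, x n\<close>, \<open>y 1, \<dots>, y m\<close> for the two samples being compared.\<close>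

definition test_stat ::
  "(real \<Rightarrow> real) \<Rightarrow> ('x \<Rightarrow> 'x \<Rightarrow> real) \<Rightarrow> nat \<Rightarrow> (nat \<Rightarrow> 'x) \<Rightarrow>
   nat \<Rightarrow> nat \<Rightarrow> (nat \<Rightarrow> 'x) \<Rightarrow> (nat \<Rightarrow> 'x) \<Rightarrow> real" where
  "test_stat h k s z n m x y =
     (let H = rkhs_of k;
          G = fun_calculus H (\<lambda>r. sqrt (h r)) (cov_op k s z)
      in 1 / (real n * (real n - 1) * real m * (real m - 1)) *
         (\<Sum>i\<in>{1..n}. \<Sum>j\<in>{1..n} - {i}. \<Sum>i'\<in>{1..m}. \<Sum>j'\<in>{1..m} - {i'}.
            finner H (G (\<lambda>u. k u (x i) - k u (y i'))) (G (\<lambda>u. k u (x j) - k u (y j')))))"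

definition mixed_sample ::
  "nat \<Rightarrow> nat \<Rightarrow> (nat \<Rightarrow> bool) \<Rightarrow> (nat \<Rightarrow> 'x) \<Rightarrow> (nat \<Rightarrow> 'x) \<Rightarrow> nat \<Rightarrow> 'x" where
  "mixed_sample n m c x y i = (if c i then x (n + i) else y (m + i))"

definition pooled :: "nat \<Rightarrow> (nat \<Rightarrow> 'x) \<Rightarrow> (nat \<Rightarrow> 'x) \<Rightarrow> nat \<Rightarrow> 'x" where
  "pooled n x y i = (if i \<le> n then x i else y (i - n))"

definition eta_hat ::
  "(real \<Rightarrow> real) \<Rightarrow> ('x \<Rightarrow> 't \<Rightarrow> real) \<Rightarrow> nat \<Rightarrow> nat \<Rightarrow> nat \<Rightarrow> nat \<Rightarrow>
   (nat \<Rightarrow> 'x) \<Rightarrow> (nat \<Rightarrow> 'x) \<Rightarrow> (nat \<Rightarrow> 't) \<Rightarrow> (nat \<Rightarrow> bool) \<Rightarrow> real" where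
  "eta_hat h \<phi> l s n m x y t c =
     test_stat h (rf_kernel \<phi> l t) s (mixed_sample n m c x y) n m x y"

definition eta_perm ::
  "(real \<Rightarrow> real) \<Rightarrow> ('x \<Rightarrow> 't \<Rightarrow> real) \<Rightarrow> nat \<Rightarrow> nat \<Rightarrow> nat \<Rightarrow> nat \<Rightarrow>
   (nat \<Rightarrow> 'x) \<Rightarrow> (nat \<Rightarrow> 'x) \<Rightarrow> (nat \<Rightarrow> 't) \<Rightarrow> (nat \<Rightarrow> bool) \<Rightarrow> (nat \<Rightarrow> nat) \<Rightarrow> real" where
  "eta_perm h \<phi> l s n m x y t c \<pi> =
     test_stat h (rf_kernel \<phi> l t) s (mixed_sample n m c x y) n m
       (\<lambda>i. pooled n x y (\<pi> i)) (\<lambda>j. pooled n x y (\<pi> (n + j)))"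

text \<open>A test based on this quantile must reject for statistics strictly above it. The permutation
  distribution always has ties (permutations inside the two samples do not change the statistic),
  and with a constant kernel the statistic equals the quantile surely, so a test rejecting at equality
  would always reject.\<close>

definition perm_quantile ::
  "real \<Rightarrow> nat \<Rightarrow> (real \<Rightarrow> real) \<Rightarrow> ('x \<Rightarrow> 't \<Rightarrow> real) \<Rightarrow> nat \<Rightarrow> nat \<Rightarrow> nat \<Rightarrow> nat \<Rightarrow>
   (nat \<Rightarrow> 'x) \<Rightarrow> (nat \<Rightarrow> 'x) \<Rightarrow> (nat \<Rightarrow> 't) \<Rightarrow> (nat \<Rightarrow> bool) \<Rightarrow>
   (nat \<Rightarrow> nat \<Rightarrow> nat) \<Rightarrow> real" where
  "perm_quantile r B h \<phi> l s n m x y t c p =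
     Inf {q. 1 / real B * (\<Sum>i\<in>{1..B}. of_bool (eta_perm h \<phi> l s n m x y t c (p i) \<le> q)) \<ge> r}"

section \<open>The randomness\<close>

text \<open>Components: the \<open>X\<close>-sample, the \<open>Y\<close>-sample, the random features, the Bernoulli variables
  and the random permutations, mutually independent. Here \<open>F\<close> is the joint law of the random
  features of all kernels.\<close>

definition sample_space ::
  "'x measure \<Rightarrow> 'x measure \<Rightarrow> 'f measure \<Rightarrow> nat \<Rightarrow> nat \<Rightarrow> nat \<Rightarrow> nat \<Rightarrow>
   ((nat \<Rightarrow> 'x) \<times> (nat \<Rightarrow> 'x) \<times> 'f \<times> (nat \<Rightarrow> bool) \<times> (nat \<Rightarrow> nat \<Rightarrow> nat)) measure" where
  "sample_space P Q F N M s B =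
     (\<Pi>\<^sub>M i\<in>{1..N}. P) \<Otimes>\<^sub>M (\<Pi>\<^sub>M i\<in>{1..M}. Q) \<Otimes>\<^sub>M F \<Otimes>\<^sub>M
     (\<Pi>\<^sub>M i\<in>{1..s}. measure_pmf (bernoulli_pmf (1/2))) \<Otimes>\<^sub>M
     (\<Pi>\<^sub>M i\<in>{1..B}. measure_pmf (pmf_of_set {\<pi>. \<pi> permutes {1..(N - s) + (M - s)}}))"

text \<open>The law of the features leaves the dependence between features of different kernels
  unspecified; only the law for each single kernel is prescribed.\<close>

definition feature_law ::
  "'k set \<Rightarrow> ('k \<Rightarrow> 't measure) \<Rightarrow> nat \<Rightarrow> ('k \<Rightarrow> nat \<Rightarrow> 't) measure \<Rightarrow> bool" where
  "feature_law \<K> \<Xi> l F \<longleftrightarrow> prob_space F \<and>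
     sets F = sets (\<Pi>\<^sub>M K\<in>\<K>. \<Pi>\<^sub>M i\<in>{1..l}. \<Xi> K) \<and>
     (\<forall>K\<in>\<K>. distr F (\<Pi>\<^sub>M i\<in>{1..l}. \<Xi> K) (\<lambda>t. t K) = (\<Pi>\<^sub>M i\<in>{1..l}. \<Xi> K))"

end

theory Submission
  imports Defs
begin

text \<open>Under \<open>P = Q\<close> the pooled sample is exchangeable, and permuting its first \<open>n + m\<close> places leaves
  the covariance sample alone. Hence, given everything but the permutations, the observed statistic
  and its \<open>B\<close> permuted copies are exchangeable real numbers after averaging over the symmetric
  group, so the observed one has at least \<open>r B\<close> of the copies strictly below it with probability at
  most \<open>(1 + B (1 - r)) / (B + 1)\<close>. The lower bound on \<open>B\<close> makes this at most
  \<open>\<alpha> / (\<bar>\<Lambda>\<bar> \<bar>\<K>\<bar>)\<close> when \<open>r = 1 - w \<alpha> / (\<bar>\<Lambda>\<bar> \<bar>\<K>\<bar>)\<close>, and a union bound finishes.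

  The functions \<open>g\<close> need not be measurable, so the single rejection events need not be either. The
  averaging is therefore done on the indicator of the whole union, and the union bound is only used
  pointwise, inside finite sums over permutations. If the union itself is not measurable, its
  \<open>measure\<close> is the junk value \<open>0\<close>.\<close>

section \<open>Ranks and empirical quantiles of exchangeable values\<close>

text \<open>Take the index \<open>j\<close> of smallest value among those with at least
  \<open>k\<close> values strictly below. Everything strictly below \<open>u j\<close> lies outside
  that set of indices, so the sizes of the two disjoint sets add up to at most
  \<open>card I\<close>. Ties do no harm because only strict comparisons count.\<close>

lemma card_high_rank_le:
  fixes u :: "'i \<Rightarrow> real" and k :: real
  assumes "finite I" "k \<le> card I"
  shows "card {j\<in>I. k \<le> card {i\<in>I. u i < u j}} \<le> card I - k"
proof (cases "{j\<in>I. k \<le> card {i\<in>I. u i < u j}} = {}")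
  case True
  then show ?thesis using assms(2) by (simp only: card.empty)
next
  case False
  let ?J = "{j\<in>I. k \<le> card {i\<in>I. u i < u j}}"
  have "finite ?J" using assms(1) by simp
  then obtain j where j: "j \<in> ?J" "\<And>i. i \<in> ?J \<Longrightarrow> u j \<le> u i"
    using False arg_min_if_finite[of ?J u] by (metis (no_types, lifting) linorder_not_less)
  have "card {i\<in>I. u i < u j} + card ?J = card ({i\<in>I. u i < u j} \<union> ?J)"
    using assms(1) j(2) by (intro card_Un_disjoint[symmetric]) (auto simp: not_less[symmetric])
  also have "\<dots> \<le> card I"
    using assms(1) by (intro card_mono) auto
  finally show ?thesis using j(1) by simp
qed

text \<open>Double counting of pairs (\<open>\<tau>\<close>, \<open>j\<close>) in which slot
  \<open>j\<close> has high rank under \<open>\<tau>\<close>: by symmetry all \<open>B + 1\<close>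
  slots occur in equally many pairs, and for fixed \<open>\<tau>\<close> at most
  \<open>B + 1 - k\<close> slots qualify.\<close>

lemma card_PiE_high_rank_le:
  fixes v :: "'a \<Rightarrow> real" and k :: real
  assumes "finite A" "k \<le> real B + 1"
  shows "(real B + 1) * card {\<tau> \<in> {0..B} \<rightarrow>\<^sub>E A. k \<le> card {i\<in>{0..B}. v (\<tau> i) < v (\<tau> 0)}}
    \<le> (real B + 1 - k) * real (card A) ^ (B + 1)"
proof -
  define \<Omega> where "\<Omega> = {0..B} \<rightarrow>\<^sub>E A"
  define D where "D j = {\<tau> \<in> \<Omega>. k \<le> card {i\<in>{0..B}. v (\<tau> i) < v (\<tau> j)}}" for j
  have fin: "finite \<Omega>" unfolding \<Omega>_def using assms(1) by (intro finite_PiE) auto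
  have cardD: "card (D j) = card (D 0)" if "j \<in> {0..B}" for j
  proof -
    let ?t = "Transposition.transpose 0 j"
    have t: "?t i \<in> {0..B} \<longleftrightarrow> i \<in> {0..B}" for i
      using that by (auto simp: Transposition.transpose_def)
    \<comment> \<open>Precomposing with the transposition only relabels the slots, so the number of
      values below a threshold stays the same while slots 0 and \<open>j\<close> trade
      places.\<close>
    have count: "card {i\<in>{0..B}. v (\<tau> (?t i)) < r} = card {i\<in>{0..B}. v (\<tau> i) < r}" for \<tau> r
      using t by (intro bij_betw_same_card[of ?t] bij_betw_byWitness[where f' = ?t]) auto
    have mem: "\<tau> \<circ> ?t \<in> \<Omega>" if "\<tau> \<in> \<Omega>" for \<tau>
      using that t unfolding \<Omega>_def PiE_iff extensional_def o_def by auto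
    have cond: "card {i\<in>{0..B}. v ((\<tau> \<circ> ?t) i) < v ((\<tau> \<circ> ?t) j')}
        = card {i\<in>{0..B}. v (\<tau> i) < v (\<tau> (?t j'))}" for \<tau> j'
      using count by simp
    have move: "\<tau> \<circ> ?t \<in> D j'" if "\<tau> \<in> D (?t j')" for \<tau> j'
      using that mem unfolding D_def mem_Collect_eq cond by blast
    have "bij_betw (\<lambda>\<tau>. \<tau> \<circ> ?t) (D j) (D 0)"
      by (rule bij_betw_byWitness[where f' = "\<lambda>\<tau>. \<tau> \<circ> ?t"])
        (use move[of _ 0] move[of _ j] in \<open>auto simp: comp_assoc\<close>)
    then show ?thesis by (rule bij_betw_same_card)
  qed
  have "(real B + 1) * card (D 0) = (\<Sum>j\<in>{0..B}. real (card (D 0)))"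
    by simp
  also have "\<dots> = (\<Sum>j\<in>{0..B}. real (card (D j)))"
    using cardD[symmetric] by (intro sum.cong arg_cong[where f = real] refl)
  also have "\<dots> = (\<Sum>j\<in>{0..B}. \<Sum>\<tau>\<in>\<Omega>. of_bool (\<tau> \<in> D j))"
    using fin by (intro sum.cong refl) (auto simp: D_def of_bool_def sum.If_cases Int_def)
  also have "\<dots> = (\<Sum>\<tau>\<in>\<Omega>. \<Sum>j\<in>{0..B}. of_bool (\<tau> \<in> D j))"
    by (rule sum.swap)
  also have "\<dots> = (\<Sum>\<tau>\<in>\<Omega>. real (card {j\<in>{0..B}. k \<le> card {i\<in>{0..B}. v (\<tau> i) < v (\<tau> j)}}))"
    by (intro sum.cong refl) (auto simp: D_def of_bool_def sum.If_cases Int_def)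
  also have "\<dots> \<le> (\<Sum>\<tau>\<in>\<Omega>. real B + 1 - k)"
    using assms(2) card_high_rank_le[of "{0..B}" k] by (intro sum_mono) (simp add: add.commute)
  also have "\<dots> = (real B + 1 - k) * real (card A) ^ (B + 1)"
    by (simp add: \<Omega>_def card_PiE)
  finally show ?thesis by (simp add: D_def \<Omega>_def)
qed

text \<open>The observation \<open>a\<close> and the \<open>B\<close> draws are packed into one
  function on \<open>{0..B}\<close> with \<open>a\<close> in slot 0, which makes the observation
  exchangeable with the draws.\<close>

lemma card_independent_high_rank_le:
  fixes v :: "'a \<Rightarrow> real" and k :: real
  assumes "finite A" "k \<le> real B + 1"
  shows "(real B + 1) *
      card {(a, p) \<in> A \<times> ({1..B} \<rightarrow>\<^sub>E A). k \<le> card {i\<in>{1..B}. v (p i) < v a}}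
    \<le> (real B + 1 - k) * real (card A) ^ (B + 1)"
proof -
  let ?S = "{(a, p) \<in> A \<times> ({1..B} \<rightarrow>\<^sub>E A). k \<le> card {i\<in>{1..B}. v (p i) < v a}}"
  let ?D = "{\<tau> \<in> {0..B} \<rightarrow>\<^sub>E A. k \<le> card {i\<in>{0..B}. v (\<tau> i) < v (\<tau> 0)}}"
  have ins: "{0..B} = insert 0 {1..B}" by auto
  have "card ?S \<le> card ?D"
  proof (rule card_inj_on_le)
    show "inj_on (\<lambda>(a, p). p(0 := a)) ?S"
      by (rule inj_on_subset[OF inj_combinator[where S = "{1..B}" and T = "\<lambda>_. A"]]) auto
    \<comment> \<open>Slot 0 holds \<open>a\<close> itself and \<open>v a < v a\<close> is false, so
      including it leaves the count unchanged.\<close>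
    have "{i\<in>{0..B}. v ((p(0 := a)) i) < v a} = {i\<in>{1..B}. v (p i) < v a}" for p a
      by (auto simp: not_less_eq_eq Suc_le_eq)
    moreover have "p(0 := a) \<in> {0..B} \<rightarrow>\<^sub>E A" if "a \<in> A" "p \<in> {1..B} \<rightarrow>\<^sub>E A" for a p
      unfolding ins using that by (rule PiE_fun_upd)
    ultimately show "(\<lambda>(a, p). p(0 := a)) ` ?S \<subseteq> ?D"
      by (clarsimp simp only: image_subset_iff mem_Collect_eq prod.case mem_Sigma_iff fun_upd_same)
        simp
    show "finite ?D" using assms(1) by (simp add: finite_PiE)
  qed
  then have "(real B + 1) * card ?S \<le> (real B + 1) * card ?D"
    by (intro mult_left_mono) auto
  also note card_PiE_high_rank_le[OF assms]
  finally show ?thesis .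
qed

text \<open>If the infimum is strictly below \<open>a\<close>, some \<open>q < a\<close> already has
  a fraction \<open>r\<close> of the sample at or below it, and that fraction lies strictly below
  \<open>a\<close>.\<close>

lemma empirical_quantile_less:
  fixes u :: "nat \<Rightarrow> real"
  assumes "B > 0" "r \<le> 1"
    and "Inf {q. 1 / real B * (\<Sum>i\<in>{1..B}. of_bool (u i \<le> q)) \<ge> r} < a"
  shows "r * real B \<le> card {i\<in>{1..B}. u i < a}"
proof -
  let ?S = "{q. 1 / real B * (\<Sum>i\<in>{1..B}. of_bool (u i \<le> q)) \<ge> r}"
  \<comment> \<open>The maximum is a member because \<open>r \<le> 1\<close>; nonemptiness is what
    allows an element below \<open>a\<close> to be extracted from the infimum.\<close>
  have "(\<Sum>i\<in>{1..B}. of_bool (u i \<le> Max (u ` {1..B}))) = (\<Sum>i\<in>{1..B}. 1::real)"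
    by (intro sum.cong refl) simp
  also have "\<dots> = real B" by simp
  finally have "Max (u ` {1..B}) \<in> ?S" using assms(1,2) by (simp only: mem_Collect_eq) simp
  then obtain q where q: "q \<in> ?S" "q < a"
    using cInf_lessD[OF _ assms(3)] by blast
  have "r * real B \<le> (\<Sum>i\<in>{1..B}. of_bool (u i \<le> q))"
    using q(1) assms(1) by (simp add: field_simps)
  also have "\<dots> \<le> (\<Sum>i\<in>{1..B}. of_bool (u i < a))"
    using q(2) by (intro sum_mono) auto
  also have "\<dots> = card {i\<in>{1..B}. u i < a}"
    by (auto simp: of_bool_def sum.If_cases Int_def)
  finally show ?thesis .
qed

text \<open>Left composition with \<open>\<pi>\<close> maps the uniform distribution of \<open>p\<close> to itself, which makes the
  observed arrangement \<open>\<pi>\<close> and the draws \<open>\<pi> \<circ> p i\<close> independent.\<close>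
lemma sum_permutation_test_le:
  fixes v :: "('i \<Rightarrow> 'i) \<Rightarrow> real" and r :: real
  assumes "finite I" "B > 0" "r \<le> 1"
  defines "A \<equiv> {\<pi>. \<pi> permutes I}"
  shows "(real B + 1) * (\<Sum>\<pi>\<in>A. \<Sum>p\<in>{1..B} \<rightarrow>\<^sub>E A.
      of_bool (Inf {q. 1 / real B * (\<Sum>i\<in>{1..B}. of_bool (v (\<pi> \<circ> p i) \<le> q)) \<ge> r} < v \<pi>))
    \<le> (1 + real B * (1 - r)) * real (card A) ^ (B + 1)"
proof -
  let ?\<Omega> = "{1..B} \<rightarrow>\<^sub>E A"
  let ?c = "\<lambda>p \<pi>. r * real B \<le> card {i\<in>{1..B}. v (p i) < v \<pi>}"
  have finA: "finite A" unfolding A_def using assms(1) by (rule finite_permutations)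
  then have fin: "finite ?\<Omega>" by (simp add: finite_PiE)
  have shift: "(\<Sum>p\<in>?\<Omega>. of_bool (?c (\<lambda>i. \<pi> \<circ> p i) \<pi>)) = (\<Sum>p\<in>?\<Omega>. of_bool (?c p \<pi>) :: real)"
    if "\<pi> \<in> A" for \<pi>
  proof -
    have perm: "\<pi> permutes I" using that by (simp add: A_def)
    have "bij_betw (\<lambda>p. \<lambda>i\<in>{1..B}. \<pi> \<circ> p i) ?\<Omega> ?\<Omega>"
    proof (rule bij_betw_byWitness[where f' = "\<lambda>p. \<lambda>i\<in>{1..B}. inv \<pi> \<circ> p i"])
      show "\<forall>p\<in>?\<Omega>. (\<lambda>i\<in>{1..B}. inv \<pi> \<circ> (\<lambda>i\<in>{1..B}. \<pi> \<circ> p i) i) = p"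
        by (auto simp: restrict_def PiE_iff extensional_def fun_eq_iff permutes_inverses[OF perm])
      show "\<forall>p\<in>?\<Omega>. (\<lambda>i\<in>{1..B}. \<pi> \<circ> (\<lambda>i\<in>{1..B}. inv \<pi> \<circ> p i) i) = p"
        by (auto simp: restrict_def PiE_iff extensional_def fun_eq_iff permutes_inverses[OF perm])
      show "(\<lambda>p. \<lambda>i\<in>{1..B}. \<pi> \<circ> p i) ` ?\<Omega> \<subseteq> ?\<Omega>"
        using perm by (auto simp: A_def PiE_iff intro!: permutes_compose)
      show "(\<lambda>p. \<lambda>i\<in>{1..B}. inv \<pi> \<circ> p i) ` ?\<Omega> \<subseteq> ?\<Omega>"
        using permutes_inv[OF perm] by (auto simp: A_def PiE_iff intro!: permutes_compose)
    qed
    note sum.reindex_bij_betw[OF this, of "\<lambda>p. of_bool (?c p \<pi>) :: real"]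
    moreover have "{i\<in>{1..B}. v ((\<lambda>i\<in>{1..B}. \<pi> \<circ> p i) i) < v \<pi>}
        = {i\<in>{1..B}. v (\<pi> \<circ> p i) < v \<pi>}" for p by auto
    ultimately show ?thesis by simp
  qed
  have "(\<Sum>\<pi>\<in>A. \<Sum>p\<in>?\<Omega>.
      of_bool (Inf {q. 1 / real B * (\<Sum>i\<in>{1..B}. of_bool (v (\<pi> \<circ> p i) \<le> q)) \<ge> r} < v \<pi>))
    \<le> (\<Sum>\<pi>\<in>A. \<Sum>p\<in>?\<Omega>. of_bool (?c (\<lambda>i. \<pi> \<circ> p i) \<pi>) :: real)"
    by (intro sum_mono) (use empirical_quantile_less[OF assms(2,3)] in \<open>simp add: of_bool_def\<close>)
  also have "\<dots> = (\<Sum>\<pi>\<in>A. \<Sum>p\<in>?\<Omega>. of_bool (?c p \<pi>))"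
    by (rule sum.cong[OF refl shift])
  also have "\<dots> = (\<Sum>z\<in>A \<times> ?\<Omega>. of_bool (?c (snd z) (fst z)))"
    by (simp add: sum.cartesian_product split_def)
  also have "\<dots> = card {(\<pi>, p) \<in> A \<times> ?\<Omega>. ?c p \<pi>}"
    using fin finA by (simp add: of_bool_def sum.If_cases Int_def split_def mem_Times_iff)
  finally have "(real B + 1) * (\<Sum>\<pi>\<in>A. \<Sum>p\<in>?\<Omega>.
      of_bool (Inf {q. 1 / real B * (\<Sum>i\<in>{1..B}. of_bool (v (\<pi> \<circ> p i) \<le> q)) \<ge> r} < v \<pi>))
    \<le> (real B + 1) * card {(\<pi>, p) \<in> A \<times> ?\<Omega>. ?c p \<pi>}"
    by (intro mult_left_mono) auto
  \<comment> \<open>The rank bound is used with \<open>k = r * B\<close>, where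
    \<open>B + 1 - k\<close> equals \<open>1 + B * (1 - r)\<close>; the inequality here yields its
    side condition \<open>k \<le> B + 1\<close>.\<close>
  also have "r * real B \<le> 1 * real B" using assms(3) by (intro mult_right_mono) auto
  then have "(real B + 1) * card {(\<pi>, p) \<in> A \<times> ?\<Omega>. ?c p \<pi>}
      \<le> (real B + 1 - r * real B) * real (card A) ^ (B + 1)"
    using finA by (intro card_independent_high_rank_le) auto
  finally show ?thesis by (simp add: algebra_simps)
qed

section \<open>From the number of permutations to the level of a single test\<close>

text \<open>The bound on \<open>B\<close> enters through its consequence
  \<open>1 / \<beta>\<^sup>2 \<le> B\<close>, and the second claim is a rearrangement of
  \<open>1 - \<beta> \<le> B * \<beta> * (1 - w)\<close>.\<close>

lemma level_le_of_many_permutations: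
  fixes \<beta> w w' :: real
  assumes "0 < \<beta>" "\<beta> \<le> 1" "0 < w'" "w' < w" "w < 1/2"
    and B: "1 / (2 * w'\<^sup>2 * \<beta>\<^sup>2) * ln (2 / (\<beta> * (1 - w - w'))) \<le> B"
  shows "0 < B" "1 + B * (w * \<beta>) \<le> \<beta> * (B + 1)"
proof -
  \<comment> \<open>The argument of the logarithm is at least 2, so the logarithm is at least 1/2.
    Further down, \<open>w' < 1/2\<close> bounds the factor in front of it from below by
    \<open>2 / \<beta>\<^sup>2\<close>.\<close>
  have "\<beta> * (1 - w - w') \<le> 1 * 1" using assms by (intro mult_mono) auto
  moreover have "0 < \<beta> * (1 - w - w')" using assms by (intro mult_pos_pos) auto
  ultimately have "2 \<le> 2 / (\<beta> * (1 - w - w'))" by (simp add: field_simps)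
  then have "ln 2 \<le> ln (2 / (\<beta> * (1 - w - w')))" by (subst ln_le_cancel_iff) linarith+
  moreover have "1/2 \<le> ln (2::real)" using ln_ge_iff[of 2 "1/2"] exp_half_le2 by simp
  ultimately have l: "1/2 \<le> ln (2 / (\<beta> * (1 - w - w')))" by simp
  have "w'\<^sup>2 \<le> (1/2)\<^sup>2" using assms by (intro power_mono) auto
  then have "2 * w'\<^sup>2 * \<beta>\<^sup>2 \<le> (1/2) * \<beta>\<^sup>2" using assms by (intro mult_right_mono) (auto simp: power2_eq_square)
  then have "1 / ((1/2) * \<beta>\<^sup>2) \<le> 1 / (2 * w'\<^sup>2 * \<beta>\<^sup>2)"
    using assms by (intro divide_left_mono) auto
  with l have "1 / ((1/2) * \<beta>\<^sup>2) * (1/2) \<le> 1 / (2 * w'\<^sup>2 * \<beta>\<^sup>2) * ln (2 / (\<beta> * (1 - w - w')))"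
    by (intro mult_mono) auto
  with B have B': "1 / \<beta>\<^sup>2 \<le> B" by simp
  moreover have "0 < 1 / \<beta>\<^sup>2" using assms by simp
  ultimately show "0 < B" by linarith
  have "1 \<le> B * \<beta>\<^sup>2" using B' assms by (simp add: field_simps)
  \<comment> \<open>After multiplication of the target by \<beta>, the left side is at most 1/4 and
    the right side, by \<open>w < 1/2\<close>, at least 1/2.\<close>
  have "\<beta> * (1 - \<beta>) \<le> 1/4" using zero_le_power2[of "\<beta> - 1/2"] by (simp add: power2_eq_square algebra_simps)
  then have "\<beta> * (1 - \<beta>) \<le> \<beta> * (B * \<beta> * (1 - w))"
  proof -
    have "1 * (1/2) \<le> B * \<beta>\<^sup>2 * (1 - w)" using \<open>1 \<le> B * \<beta>\<^sup>2\<close> assms by (intro mult_mono) auto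
    then show ?thesis using \<open>\<beta> * (1 - \<beta>) \<le> 1/4\<close> by (simp add: power2_eq_square algebra_simps)
  qed
  then have "1 - \<beta> \<le> B * \<beta> * (1 - w)" using assms by (subst (asm) mult_le_cancel_left_pos) auto
  then show "1 + B * (w * \<beta>) \<le> \<beta> * (B + 1)" by (simp add: algebra_simps)
qed

section \<open>Integrating over random permutations and averaging over invariances\<close>

text \<open>The product of uniform laws sits on finitely many atoms of equal mass, so the integral
  is a finite sum for every \<open>f\<close>, measurable or not.\<close>

lemma nn_integral_PiM_pmf_of_set:
  assumes "finite I" "finite A" "A \<noteq> {}"
  shows "(\<integral>\<^sup>+p. f p \<partial>(\<Pi>\<^sub>M i\<in>I. measure_pmf (pmf_of_set A)))
    = (\<Sum>p\<in>I \<rightarrow>\<^sub>E A. f p * ennreal (1 / real (card A) ^ card I))"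
proof -
  let ?U = "measure_pmf (pmf_of_set A)"
  let ?M = "\<Pi>\<^sub>M i\<in>I. ?U"
  interpret product_prob_space "\<lambda>_. ?U" I by standard
  have fin: "finite (I \<rightarrow>\<^sub>E A)" using assms by (intro finite_PiE)
  \<comment> \<open>A singleton is a box of singletons because \<open>p\<close> is
    \<open>undefined\<close> outside \<open>I\<close>; hence it is measurable and its mass is a
    product.\<close>
  have singleton: "{p} = (\<Pi>\<^sub>E i\<in>I. {p i})" if "p \<in> I \<rightarrow>\<^sub>E A" for p
    using PiE_singleton[of p I] that by (auto simp: PiE_def)
  have sets: "{p} \<in> sets ?M" if "p \<in> I \<rightarrow>\<^sub>E A" for p
    by (subst singleton[OF that]) (intro sets_PiM_I_finite assms; simp)
  have mass: "emeasure ?M {p} = ennreal (1 / real (card A) ^ card I)" if "p \<in> I \<rightarrow>\<^sub>E A" for p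
  proof -
    have "emeasure ?M {p} = (\<Prod>i\<in>I. emeasure ?U {p i})"
      by (subst singleton[OF that]) (intro emeasure_PiM assms; simp)
    also have "\<dots> = (\<Prod>i\<in>I. ennreal (1 / card A))"
      using that assms by (intro prod.cong refl) (auto simp: emeasure_pmf_single PiE_iff)
    finally show ?thesis
      by (simp add: ennreal_power power_divide)
  qed
  have "AE p in ?M. \<forall>i\<in>I. p i \<in> A"
    using assms by (intro AE_finite_allI AE_PiM_component)
      (auto simp: AE_measure_pmf_iff prob_space_measure_pmf)
  then have "AE p in ?M. p \<in> I \<rightarrow>\<^sub>E A"
    using AE_space by eventually_elim (auto simp: space_PiM PiE_iff)
  \<comment> \<open>Almost everywhere \<open>f\<close> agrees with a combination of indicators of
    atoms, and this combination is measurable.\<close>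
  then have "AE p in ?M. f p = (\<Sum>q\<in>I \<rightarrow>\<^sub>E A. f q * indicator {q} p)"
    by eventually_elim (auto simp: indicator_def sum.delta' fin if_distrib cong: if_cong)
  then have "(\<integral>\<^sup>+p. f p \<partial>?M) = (\<integral>\<^sup>+p. (\<Sum>q\<in>I \<rightarrow>\<^sub>E A. f q * indicator {q} p) \<partial>?M)"
    by (rule nn_integral_cong_AE)
  also have "\<dots> = (\<Sum>q\<in>I \<rightarrow>\<^sub>E A. f q * emeasure ?M {q})"
    using sets by (simp add: nn_integral_sum nn_integral_cmult_indicator)
  finally show ?thesis by (simp add: mass)
qed

text \<open>Each \<open>S \<pi>\<close> preserves the law of the pair, so moving the pair by any
  \<pi> leaves the integral unchanged, and the integral equals its average over \<open>G\<close>.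
  That average is bounded pointwise, with all components but the last held fixed.\<close>

lemma nn_integral_pair_invariant_average:
  fixes M1 :: "'a measure" and M2 :: "'b measure" and R1 :: "'c measure"
    and R2 :: "'d measure" and R3 :: "'e measure"
  assumes prob: "prob_space M1" "prob_space M2" "prob_space R1" "prob_space R2" "prob_space R3"
    and G: "finite G" "G \<noteq> {}"
    and T: "\<And>\<pi>. \<pi> \<in> G \<Longrightarrow> S \<pi> \<in> measurable (M1 \<Otimes>\<^sub>M M2) (M1 \<Otimes>\<^sub>M M2)"
      "\<And>\<pi>. \<pi> \<in> G \<Longrightarrow> distr (M1 \<Otimes>\<^sub>M M2) (M1 \<Otimes>\<^sub>M M2) (S \<pi>) = M1 \<Otimes>\<^sub>M M2"
    and f: "f \<in> borel_measurable (M1 \<Otimes>\<^sub>M M2 \<Otimes>\<^sub>M R1 \<Otimes>\<^sub>M R2 \<Otimes>\<^sub>M R3)"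
    and le: "\<And>x y t c. x \<in> space M1 \<Longrightarrow> y \<in> space M2 \<Longrightarrow> t \<in> space R1 \<Longrightarrow> c \<in> space R2 \<Longrightarrow>
      (\<Sum>\<pi>\<in>G. \<integral>\<^sup>+p. f (fst (S \<pi> (x, y)), snd (S \<pi> (x, y)), t, c, p) \<partial>R3) \<le> ennreal C * of_nat (card G)"
  shows "(\<integral>\<^sup>+\<omega>. f \<omega> \<partial>(M1 \<Otimes>\<^sub>M M2 \<Otimes>\<^sub>M R1 \<Otimes>\<^sub>M R2 \<Otimes>\<^sub>M R3)) \<le> ennreal C"
proof -
  interpret M1: prob_space M1 by fact
  interpret M2: prob_space M2 by fact
  interpret R1: prob_space R1 by fact
  interpret R2: prob_space R2 by fact
  interpret R3: prob_space R3 by fact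
  interpret R23: pair_prob_space R2 R3 by standard
  interpret R: pair_prob_space R1 "R2 \<Otimes>\<^sub>M R3" by standard
  interpret M2R: pair_prob_space M2 "R1 \<Otimes>\<^sub>M R2 \<Otimes>\<^sub>M R3" by standard
  interpret M12: pair_prob_space M1 M2 by standard
  note [measurable] = f
  let ?M = "M1 \<Otimes>\<^sub>M M2"
  \<comment> \<open>With the last component integrated out, the sum in \<open>le\<close> becomes the
    sum of \<open>h (S \<pi> z, t, c)\<close> over \<open>G\<close>.\<close>
  define h where "h = (\<lambda>(z, t, c). \<integral>\<^sup>+p. f (fst z, snd z, t, c, p) \<partial>R3)"
  have h[measurable]: "h \<in> borel_measurable (?M \<Otimes>\<^sub>M R1 \<Otimes>\<^sub>M R2)"
    unfolding h_def by measurable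
  have "(\<integral>\<^sup>+\<omega>. f \<omega> \<partial>(M1 \<Otimes>\<^sub>M M2 \<Otimes>\<^sub>M R1 \<Otimes>\<^sub>M R2 \<Otimes>\<^sub>M R3))
      = (\<integral>\<^sup>+x. \<integral>\<^sup>+\<omega>. f (x, \<omega>) \<partial>(M2 \<Otimes>\<^sub>M R1 \<Otimes>\<^sub>M R2 \<Otimes>\<^sub>M R3) \<partial>M1)"
    by (rule M2R.P.nn_integral_fst[symmetric]) measurable
  also have "\<dots> = (\<integral>\<^sup>+x. \<integral>\<^sup>+y. \<integral>\<^sup>+r. f (x, y, r) \<partial>(R1 \<Otimes>\<^sub>M R2 \<Otimes>\<^sub>M R3) \<partial>M2 \<partial>M1)"
    by (intro nn_integral_cong R.P.nn_integral_fst[symmetric]) measurable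
  also have "\<dots> = (\<integral>\<^sup>+z. \<integral>\<^sup>+r. f (fst z, snd z, r) \<partial>(R1 \<Otimes>\<^sub>M R2 \<Otimes>\<^sub>M R3) \<partial>?M)"
    using M2.nn_integral_fst[of "\<lambda>z. \<integral>\<^sup>+r. f (fst z, snd z, r) \<partial>(R1 \<Otimes>\<^sub>M R2 \<Otimes>\<^sub>M R3)" M1] by simp
  also have "\<dots> = (\<integral>\<^sup>+z. \<integral>\<^sup>+t. \<integral>\<^sup>+c. h (z, t, c) \<partial>R2 \<partial>R1 \<partial>?M)"
  proof (intro nn_integral_cong)
    fix z assume z: "z \<in> space ?M"
    then have [measurable]: "fst z \<in> space M1" "snd z \<in> space M2"
      by (auto simp: space_pair_measure)
    have "(\<integral>\<^sup>+r. f (fst z, snd z, r) \<partial>(R1 \<Otimes>\<^sub>M R2 \<Otimes>\<^sub>M R3))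
        = (\<integral>\<^sup>+t. \<integral>\<^sup>+cp. f (fst z, snd z, t, cp) \<partial>(R2 \<Otimes>\<^sub>M R3) \<partial>R1)"
      by (rule R23.P.nn_integral_fst[symmetric]) measurable
    also have "\<dots> = (\<integral>\<^sup>+t. \<integral>\<^sup>+c. h (z, t, c) \<partial>R2 \<partial>R1)"
      unfolding h_def prod.case
      by (intro nn_integral_cong R3.nn_integral_fst[symmetric]) measurable
    finally show "(\<integral>\<^sup>+r. f (fst z, snd z, r) \<partial>(R1 \<Otimes>\<^sub>M R2 \<Otimes>\<^sub>M R3))
        = (\<integral>\<^sup>+t. \<integral>\<^sup>+c. h (z, t, c) \<partial>R2 \<partial>R1)" .
  qed
  finally have int: "(\<integral>\<^sup>+\<omega>. f \<omega> \<partial>(M1 \<Otimes>\<^sub>M M2 \<Otimes>\<^sub>M R1 \<Otimes>\<^sub>M R2 \<Otimes>\<^sub>M R3))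
      = (\<integral>\<^sup>+z. \<integral>\<^sup>+t. \<integral>\<^sup>+c. h (z, t, c) \<partial>R2 \<partial>R1 \<partial>?M)" (is "?I = _") .
  have inv: "?I = (\<integral>\<^sup>+z. \<integral>\<^sup>+t. \<integral>\<^sup>+c. h (S \<pi> z, t, c) \<partial>R2 \<partial>R1 \<partial>?M)" if "\<pi> \<in> G" for \<pi>
    unfolding int
    by (subst T(2)[OF that, symmetric], rule nn_integral_distr[OF T(1)[OF that]]) simp
  have "of_nat (card G) * ?I = (\<Sum>\<pi>\<in>G. \<integral>\<^sup>+z. \<integral>\<^sup>+t. \<integral>\<^sup>+c. h (S \<pi> z, t, c) \<partial>R2 \<partial>R1 \<partial>?M)"
    using inv by (simp flip: sum_constant)
  also have "\<dots> = (\<integral>\<^sup>+z. (\<Sum>\<pi>\<in>G. \<integral>\<^sup>+t. \<integral>\<^sup>+c. h (S \<pi> z, t, c) \<partial>R2 \<partial>R1) \<partial>?M)"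
  proof (rule nn_integral_sum[symmetric])
    fix \<pi> assume "\<pi> \<in> G"
    note [measurable] = T(1)[OF this]
    show "(\<lambda>z. \<integral>\<^sup>+t. \<integral>\<^sup>+c. h (S \<pi> z, t, c) \<partial>R2 \<partial>R1) \<in> borel_measurable ?M" by measurable
  qed
  also have "\<dots> = (\<integral>\<^sup>+z. \<integral>\<^sup>+t. \<integral>\<^sup>+c. (\<Sum>\<pi>\<in>G. h (S \<pi> z, t, c)) \<partial>R2 \<partial>R1 \<partial>?M)"
  proof (intro nn_integral_cong)
    fix z assume z: "z \<in> space ?M"
    have meas: "(\<lambda>tc. h (S \<pi> z, tc)) \<in> borel_measurable (R1 \<Otimes>\<^sub>M R2)" if "\<pi> \<in> G" for \<pi>
    proof -
      have [measurable]: "S \<pi> z \<in> space ?M" by (rule measurable_space[OF T(1)[OF that] z])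
      show ?thesis by measurable
    qed
    have "(\<Sum>\<pi>\<in>G. \<integral>\<^sup>+t. \<integral>\<^sup>+c. h (S \<pi> z, t, c) \<partial>R2 \<partial>R1)
        = (\<integral>\<^sup>+t. (\<Sum>\<pi>\<in>G. \<integral>\<^sup>+c. h (S \<pi> z, t, c) \<partial>R2) \<partial>R1)"
      by (rule nn_integral_sum[symmetric]) (use meas in measurable)
    also have "\<dots> = (\<integral>\<^sup>+t. \<integral>\<^sup>+c. (\<Sum>\<pi>\<in>G. h (S \<pi> z, t, c)) \<partial>R2 \<partial>R1)"
      by (intro nn_integral_cong nn_integral_sum[symmetric]) (use meas in measurable)
    finally show "(\<Sum>\<pi>\<in>G. \<integral>\<^sup>+t. \<integral>\<^sup>+c. h (S \<pi> z, t, c) \<partial>R2 \<partial>R1)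
        = (\<integral>\<^sup>+t. \<integral>\<^sup>+c. (\<Sum>\<pi>\<in>G. h (S \<pi> z, t, c)) \<partial>R2 \<partial>R1)" .
  qed
  also have "\<dots> \<le> (\<integral>\<^sup>+z. \<integral>\<^sup>+t. \<integral>\<^sup>+c. ennreal C * of_nat (card G) \<partial>R2 \<partial>R1 \<partial>?M)"
    using le by (intro nn_integral_mono) (auto simp: h_def space_pair_measure)
  also have "\<dots> = of_nat (card G) * ennreal C"
    by (simp add: R2.emeasure_space_1 R1.emeasure_space_1 M12.P.emeasure_space_1 mult.commute)
  finally show ?thesis
    using G by (subst (asm) ennreal_mult_le_mult_iff) (auto simp: of_nat_eq_0_iff)
qed

section \<open>Invariance of the law of the two samples under permutations of the pool\<close>

text \<open>Coordinates beyond \<open>n\<close> and \<open>m\<close> stay in place since they supply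
  the covariance sample.\<close>

definition permute_samples ::
  "nat \<Rightarrow> nat \<Rightarrow> (nat \<Rightarrow> nat) \<Rightarrow> (nat \<Rightarrow> 'x) \<times> (nat \<Rightarrow> 'x) \<Rightarrow> (nat \<Rightarrow> 'x) \<times> (nat \<Rightarrow> 'x)" where
  "permute_samples n m \<pi> = (\<lambda>(x, y).
     (\<lambda>i. if i \<in> {1..n} then pooled n x y (\<pi> i) else x i,
      \<lambda>j. if j \<in> {1..m} then pooled n x y (\<pi> (n + j)) else y j))"

text \<open>The pair becomes one i.i.d. sample of length \<open>N + M\<close>, on which permuting
  the pool is a reindexing of a power of \<open>P\<close>. The restriction keeps the result in the
  extensional function space.\<close>

definition merge_samples :: "nat \<Rightarrow> nat \<Rightarrow> (nat \<Rightarrow> 'x) \<times> (nat \<Rightarrow> 'x) \<Rightarrow> nat \<Rightarrow> 'x" where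
  "merge_samples N M = (\<lambda>(x, y). \<lambda>k\<in>{1..N+M}. if k \<le> N then x k else y (k - N))"

definition split_samples :: "nat \<Rightarrow> nat \<Rightarrow> (nat \<Rightarrow> 'x) \<Rightarrow> (nat \<Rightarrow> 'x) \<times> (nat \<Rightarrow> 'x)" where
  "split_samples N M u = (\<lambda>i\<in>{1..N}. u i, \<lambda>j\<in>{1..M}. u (N + j))"

abbreviation iid_samples :: "'x measure \<Rightarrow> nat \<Rightarrow> nat \<Rightarrow> ((nat \<Rightarrow> 'x) \<times> (nat \<Rightarrow> 'x)) measure" where
  "iid_samples P N M \<equiv> (\<Pi>\<^sub>M i\<in>{1..N}. P) \<Otimes>\<^sub>M (\<Pi>\<^sub>M i\<in>{1..M}. P)"

lemma split_samples_merge_samples: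
  assumes "z \<in> space (iid_samples P N M)"
  shows "split_samples N M (merge_samples N M z) = z"
  using assms
  by (auto simp: split_samples_def merge_samples_def space_pair_measure space_PiM
      PiE_iff extensional_def fun_eq_iff split: prod.splits)

lemma measurable_merge_samples [measurable]:
  "merge_samples N M \<in> measurable (iid_samples P N M) (\<Pi>\<^sub>M k\<in>{1..N+M}. P)"
  unfolding merge_samples_def split_beta'
proof (rule measurable_restrict)
  fix k assume "k \<in> {1..N+M}"
  then show "(\<lambda>z. if k \<le> N then fst z k else snd z (k - N)) \<in> measurable (iid_samples P N M) P"
    by (cases "k \<le> N")
      (auto intro!: measurable_compose[OF measurable_fst measurable_component_singleton]
        measurable_compose[OF measurable_snd measurable_component_singleton])
qed

lemma measurable_split_samples [measurable]:
  "split_samples N M \<in> measurable (\<Pi>\<^sub>M k\<in>{1..N+M}. P) (iid_samples P N M)"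
  unfolding split_samples_def by measurable

text \<open>It suffices to compare masses of boxes: the preimage of a box is a product of two boxes,
  whose mass is the same product over all \<open>N + M\<close> factors.\<close>

lemma distr_merge_samples:
  assumes "prob_space P"
  shows "distr (iid_samples P N M) (\<Pi>\<^sub>M k\<in>{1..N+M}. P) (merge_samples N M) = (\<Pi>\<^sub>M k\<in>{1..N+M}. P)"
proof -
  interpret prob_space P by fact
  interpret product_sigma_finite "\<lambda>_::nat. P" by standard
  interpret Y: prob_space "\<Pi>\<^sub>M i\<in>{1..M}. P" by (intro prob_space_PiM assms)
  show ?thesis
  proof (rule PiM_eqI)
    fix A :: "nat \<Rightarrow> 'a set" assume A: "\<And>k. k \<in> {1..N+M} \<Longrightarrow> A k \<in> sets P"
    \<comment> \<open>Membership in the boxes thus implies membership in the space, so intersecting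
      the preimage with the space adds no condition.\<close>
    have sub: "A k \<subseteq> space P" if "k \<in> {1..N+M}" for k
      using sets.sets_into_space[OF A[OF that]] .
    have vim: "merge_samples N M -` (\<Pi>\<^sub>E k\<in>{1..N+M}. A k) \<inter> space (iid_samples P N M)
        = (\<Pi>\<^sub>E i\<in>{1..N}. A i) \<times> (\<Pi>\<^sub>E j\<in>{1..M}. A (N + j))" (is "?L = ?R")
    proof (intro set_eqI)
      fix z :: "(nat \<Rightarrow> 'a) \<times> (nat \<Rightarrow> 'a)"
      obtain x y where z: "z = (x, y)" by (cases z)
      have "(\<forall>k\<in>{1..N+M}. (if k \<le> N then x k else y (k - N)) \<in> A k)
          \<longleftrightarrow> (\<forall>i\<in>{1..N}. x i \<in> A i) \<and> (\<forall>j\<in>{1..M}. y j \<in> A (N + j))" (is "?l = ?r")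
      proof
        assume l: ?l
        show ?r
        proof (intro conjI ballI)
          show "x i \<in> A i" if "i \<in> {1..N}" for i using l[rule_format, of i] that by simp
          show "y j \<in> A (N + j)" if "j \<in> {1..M}" for j using l[rule_format, of "N + j"] that by simp
        qed
      next
        assume r: ?r
        show ?l
        proof
          fix k assume "k \<in> {1..N+M}"
          then show "(if k \<le> N then x k else y (k - N)) \<in> A k"
            using r[THEN conjunct1, rule_format, of k] r[THEN conjunct2, rule_format, of "k - N"]
            by (cases "k \<le> N") (auto simp: Suc_le_eq)
        qed
      qed
      then have "merge_samples N M z \<in> (\<Pi>\<^sub>E k\<in>{1..N+M}. A k)
          \<longleftrightarrow> (\<forall>i\<in>{1..N}. x i \<in> A i) \<and> (\<forall>j\<in>{1..M}. y j \<in> A (N + j))"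
        by (simp only: z merge_samples_def prod.case restrict_PiE_iff)
      moreover have "x i \<in> space P" if "x i \<in> A i" "i \<in> {1..N}" for i
        using sub[of i] that by auto
      moreover have "y j \<in> space P" if "y j \<in> A (N + j)" "j \<in> {1..M}" for j
        using sub[of "N + j"] that by auto
      ultimately show "z \<in> ?L \<longleftrightarrow> z \<in> ?R"
        unfolding z Int_iff vimage_eq space_pair_measure space_PiM PiE_iff mem_Sigma_iff by blast
    qed
    have "emeasure (distr (iid_samples P N M) (\<Pi>\<^sub>M k\<in>{1..N+M}. P) (merge_samples N M)) (Pi\<^sub>E {1..N+M} A)
        = emeasure (iid_samples P N M) ((\<Pi>\<^sub>E i\<in>{1..N}. A i) \<times> (\<Pi>\<^sub>E j\<in>{1..M}. A (N + j)))"
      using A by (subst emeasure_distr[OF measurable_merge_samples sets_PiM_I_finite])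
        (simp_all only: vim finite_atLeastAtMost)
    also have "\<dots> = emeasure (\<Pi>\<^sub>M i\<in>{1..N}. P) (\<Pi>\<^sub>E i\<in>{1..N}. A i)
        * emeasure (\<Pi>\<^sub>M i\<in>{1..M}. P) (\<Pi>\<^sub>E j\<in>{1..M}. A (N + j))"
      using A by (intro Y.emeasure_pair_measure_Times sets_PiM_I_finite) auto
    also have "\<dots> = (\<Prod>i\<in>{1..N}. emeasure P (A i)) * (\<Prod>j\<in>{1..M}. emeasure P (A (N + j)))"
      using A by (subst (1 2) emeasure_PiM) auto
    also have "(\<Prod>j\<in>{1..M}. emeasure P (A (N + j))) = (\<Prod>k\<in>{N+1..N+M}. emeasure P (A k))"
      by (rule prod.reindex_bij_witness[of _ "\<lambda>k. k - N" "\<lambda>j. N + j"]) auto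
    also have "(\<Prod>i\<in>{1..N}. emeasure P (A i)) * \<dots> = (\<Prod>k\<in>{1..N+M}. emeasure P (A k))"
      by (subst prod.union_disjoint[symmetric]) (auto intro!: prod.cong)
    finally show "emeasure (distr (iid_samples P N M) (\<Pi>\<^sub>M k\<in>{1..N+M}. P) (merge_samples N M))
        (Pi\<^sub>E {1..N+M} A) = (\<Prod>k\<in>{1..N+M}. emeasure P (A k))" .
  qed auto
qed

text \<open>The merged law is the image of the law of the pair, and splitting undoes
  merging.\<close>

lemma distr_split_samples:
  assumes "prob_space P"
  shows "distr (\<Pi>\<^sub>M k\<in>{1..N+M}. P) (iid_samples P N M) (split_samples N M) = iid_samples P N M"
proof -
  have "distr (distr (iid_samples P N M) (\<Pi>\<^sub>M k\<in>{1..N+M}. P) (merge_samples N M))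
      (iid_samples P N M) (split_samples N M)
    = distr (iid_samples P N M) (iid_samples P N M) (\<lambda>z. z)"
    by (subst distr_distr[OF measurable_split_samples measurable_merge_samples])
      (intro distr_cong refl, simp only: o_apply split_samples_merge_samples)
  then show ?thesis by (simp only: distr_merge_samples[OF assms] distr_id)
qed

text \<open>The permutation acts on the first \<open>n\<close> and \<open>m\<close> coordinates of the two samples, which sit at
  positions \<open>{1..n}\<close> and \<open>{N+1..N+m}\<close> of the merged sample.\<close>
lemma permute_samples_eq_reindex:
  assumes "\<pi> permutes {1..n+m}" "n \<le> N" "m \<le> M"
  obtains \<rho> where "inj_on \<rho> {1..N+M}" "\<rho> \<in> {1..N+M} \<rightarrow> {1..N+M}"
    "\<forall>z\<in>space (iid_samples P N M).
      permute_samples n m \<pi> z = split_samples N M (\<lambda>k\<in>{1..N+M}. merge_samples N M z (\<rho> k))"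
proof
  \<comment> \<open>\<open>e\<close> sends a position in the pool to its place in the merged sample,
    and \<open>d\<close> inverts it on the image \<open>I\<close>. \<open>\<rho>\<close> is \<pi>
    transported along \<open>e\<close>, and the identity elsewhere.\<close>
  define e where "e k = (if k \<le> n then k else k - n + N)" for k
  define d where "d k = (if k \<le> n then k else k - N + n)" for k
  define I where "I = {1..n} \<union> {N+1..N+m}"
  define \<rho> where "\<rho> k = (if k \<in> I then e (\<pi> (d k)) else k)" for k
  have \<pi>: "\<pi> k \<in> {1..n+m} \<longleftrightarrow> k \<in> {1..n+m}" for k using permutes_in_image[OF assms(1)] .
  have d: "d k \<in> {1..n+m}" "e (d k) = k" if "k \<in> I" for k
    using that assms(2) by (auto simp: I_def d_def e_def)
  have e: "e k \<in> I" "d (e k) = k" if "k \<in> {1..n+m}" for k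
    using that assms(2) by (auto simp: I_def d_def e_def)
  have I: "I \<subseteq> {1..N+M}" using assms(2,3) by (auto simp: I_def)
  have \<rho>_I: "\<rho> k \<in> I \<longleftrightarrow> k \<in> I" for k
    using e(1) d(1) \<pi> by (auto simp: \<rho>_def)
  show "inj_on \<rho> {1..N+M}"
  proof (rule inj_onI)
    fix i j assume eq: "\<rho> i = \<rho> j"
    show "i = j"
    proof (cases "i \<in> I")
      case True
      then have "j \<in> I" using \<rho>_I eq by metis
      then have "e (\<pi> (d i)) = e (\<pi> (d j))" using eq True by (simp add: \<rho>_def)
      then have "\<pi> (d i) = \<pi> (d j)" using e(2) d(1) \<pi> True \<open>j \<in> I\<close> by metis
      then have "d i = d j" using permutes_inj[OF assms(1)] by (simp add: inj_eq)
      then show ?thesis using d(2) True \<open>j \<in> I\<close> by metis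
    next
      case False
      then have "j \<notin> I" using \<rho>_I eq by metis
      then show ?thesis using False eq by (simp add: \<rho>_def)
    qed
  qed
  show \<rho>_J: "\<rho> \<in> {1..N+M} \<rightarrow> {1..N+M}"
    using I \<rho>_I by (metis \<rho>_def Pi_I subsetD)
  show "\<forall>z\<in>space (iid_samples P N M).
      permute_samples n m \<pi> z = split_samples N M (\<lambda>k\<in>{1..N+M}. merge_samples N M z (\<rho> k))"
  proof
    fix z assume z: "z \<in> space (iid_samples P N M)"
    obtain x y where xy: "z = (x, y)" by (cases z)
    \<comment> \<open>The equality is between total functions, so the default value outside the
      index ranges has to match as well.\<close>
    have undef: "x i = undefined" if "i \<notin> {1..N}" for i
      using z that by (auto simp: xy space_pair_measure space_PiM PiE_iff extensional_def)
    have undef': "y i = undefined" if "i \<notin> {1..M}" for i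
      using z that by (auto simp: xy space_pair_measure space_PiM PiE_iff extensional_def)
    have pool: "merge_samples N M z (e k) = pooled n x y k" if "k \<in> {1..n+m}" for k
      using that assms(2,3) by (auto simp: xy merge_samples_def e_def pooled_def)
    have left: "merge_samples N M z (\<rho> i) = (if i \<in> {1..n} then pooled n x y (\<pi> i) else x i)"
      if "i \<in> {1..N}" for i
    proof (cases "i \<in> {1..n}")
      case True
      then have "\<rho> i = e (\<pi> i)" by (auto simp: \<rho>_def I_def d_def)
      then show ?thesis using pool[of "\<pi> i"] \<pi>[of i] True by simp
    next
      case False
      then show ?thesis using that by (simp add: \<rho>_def I_def xy merge_samples_def)
    qed
    have right: "merge_samples N M z (\<rho> (N + j)) = (if j \<in> {1..m} then pooled n x y (\<pi> (n + j)) else y j)"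
      if "j \<in> {1..M}" for j
    proof (cases "j \<in> {1..m}")
      case True
      then have "\<rho> (N + j) = e (\<pi> (n + j))" using assms(2) by (auto simp: \<rho>_def I_def d_def add.commute)
      then show ?thesis using pool[of "\<pi> (n + j)"] \<pi>[of "n + j"] True by simp
    next
      case False
      then have "N + j \<notin> I" using assms(2) that by (auto simp: I_def)
      then show ?thesis using that False by (auto simp: \<rho>_def xy merge_samples_def)
    qed
    have "(if i \<in> {1..n} then pooled n x y (\<pi> i) else x i)
        = (\<lambda>i\<in>{1..N}. merge_samples N M z (\<rho> i)) i" for i
    proof (cases "i \<in> {1..N}")
      case True
      then show ?thesis by (simp only: left restrict_apply' if_True)
    next
      case False
      then have "i \<notin> {1..n}" using assms(2) by auto
      then show ?thesis using False undef by (simp only: restrict_apply if_False)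
    qed
    moreover have "(if j \<in> {1..m} then pooled n x y (\<pi> (n + j)) else y j)
        = (\<lambda>j\<in>{1..M}. merge_samples N M z (\<rho> (N + j))) j" for j
    proof (cases "j \<in> {1..M}")
      case True
      then show ?thesis by (simp only: right restrict_apply' if_True)
    next
      case False
      then have "j \<notin> {1..m}" using assms(3) by auto
      then show ?thesis using False undef' by (simp only: restrict_apply if_False)
    qed
    moreover have "split_samples N M (\<lambda>k\<in>{1..N+M}. merge_samples N M z (\<rho> k))
        = (\<lambda>i\<in>{1..N}. merge_samples N M z (\<rho> i), \<lambda>j\<in>{1..M}. merge_samples N M z (\<rho> (N + j)))"
      by (auto simp: split_samples_def restrict_def fun_eq_iff)
    ultimately show "permute_samples n m \<pi> z
        = split_samples N M (\<lambda>k\<in>{1..N+M}. merge_samples N M z (\<rho> k))"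
      by (simp only: permute_samples_def xy prod.case)
  qed
qed

text \<open>Permuting factors into merging, an injective reindexing of an i.i.d. sample, and
  splitting; each of the three carries the i.i.d. law to the i.i.d. law.\<close>

lemma permute_samples_invariant:
  assumes "prob_space P" "\<pi> permutes {1..n+m}" "n \<le> N" "m \<le> M"
  shows "permute_samples n m \<pi> \<in> measurable (iid_samples P N M) (iid_samples P N M)"
    and "distr (iid_samples P N M) (iid_samples P N M) (permute_samples n m \<pi>) = iid_samples P N M"
proof -
  let ?Z = "iid_samples P N M" and ?J = "\<Pi>\<^sub>M k\<in>{1..N+M}. P"
  obtain \<rho> where \<rho>: "inj_on \<rho> {1..N+M}" "\<rho> \<in> {1..N+M} \<rightarrow> {1..N+M}"
    "\<forall>z\<in>space ?Z.
      permute_samples n m \<pi> z = split_samples N M (\<lambda>k\<in>{1..N+M}. merge_samples N M z (\<rho> k))"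
    by (rule permute_samples_eq_reindex[OF assms(2-4), where P = P])
  define r where "r = (\<lambda>u::nat \<Rightarrow> 'a. \<lambda>k\<in>{1..N+M}. u (\<rho> k))"
  have r[measurable]: "r \<in> measurable ?J ?J"
    unfolding r_def using \<rho>(2) by (intro measurable_restrict measurable_component_singleton) auto
  have distr_r: "distr ?J ?J r = ?J"
    unfolding r_def using assms(1) \<rho>(1,2) by (intro distr_PiM_reindex) auto
  have eq: "permute_samples n m \<pi> z = split_samples N M (r (merge_samples N M z))" if "z \<in> space ?Z" for z
    using \<rho>(3) that by (simp add: r_def)
  show "permute_samples n m \<pi> \<in> measurable ?Z ?Z"
    by (subst measurable_cong[OF eq]) measurable
  have "distr ?Z ?Z (permute_samples n m \<pi>)
      = distr ?Z ?Z (split_samples N M \<circ> (r \<circ> merge_samples N M))"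
    using eq by (intro distr_cong) auto
  also have "\<dots> = distr (distr (distr ?Z ?J (merge_samples N M)) ?J r) ?Z (split_samples N M)"
    by (simp only: distr_distr[OF r measurable_merge_samples]
        distr_distr[OF measurable_split_samples measurable_comp[OF measurable_merge_samples r]])
  also have "\<dots> = ?Z"
    by (simp only: distr_merge_samples[OF assms(1)] distr_r distr_split_samples[OF assms(1)])
  finally show "distr ?Z ?Z (permute_samples n m \<pi>) = ?Z" .
qed

section \<open>Behaviour of statistic and quantile when the data are permuted\<close>

lemma test_stat_cong:
  assumes "\<And>i. i \<in> {1..s} \<Longrightarrow> z i = z' i"
    and "\<And>i. i \<in> {1..n} \<Longrightarrow> x i = x' i" "\<And>j. j \<in> {1..m} \<Longrightarrow> y j = y' j"
  shows "test_stat h k s z n m x y = test_stat h k s z' n m x' y'"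
proof -
  have "cov_op k s z = cov_op k s z'"
    unfolding cov_op_def using assms(1)
    by (intro ext arg_cong2[where f = "(*)"] sum.cong refl) auto
  then show ?thesis
    unfolding test_stat_def Let_def using assms(2,3)
    by (intro arg_cong2[where f = "(*)"] sum.cong refl) auto
qed

lemma pooled_permute_samples:
  assumes "k \<in> {1..n+m}" "permute_samples n m \<pi> (x, y) = (x', y')"
  shows "pooled n x' y' k = pooled n x y (\<pi> k)"
  using assms by (auto simp: pooled_def[of n x' y'] permute_samples_def)

text \<open>The covariance points sit at \<open>n + i\<close> and \<open>m + i\<close>, which for
  \<open>i \<ge> 1\<close> is past every permuted coordinate.\<close>

lemma mixed_sample_permute_samples:
  assumes "i \<ge> 1" "permute_samples n m \<pi> (x, y) = (x', y')"
  shows "mixed_sample n m c x' y' i = mixed_sample n m c x y i"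
  using assms by (auto simp: mixed_sample_def permute_samples_def)

lemma eta_hat_permute_samples:
  assumes "permute_samples n m \<pi> (x, y) = (x', y')"
  shows "eta_hat h \<phi> l s n m x' y' t c = eta_perm h \<phi> l s n m x y t c \<pi>"
  unfolding eta_hat_def eta_perm_def using assms mixed_sample_permute_samples[OF _ assms]
  by (intro test_stat_cong) (auto simp: permute_samples_def)

text \<open>Position \<open>k\<close> of the rearranged pool holds the old entry
  \<open>\<pi> k\<close>, so reading it through \<open>\<tau>\<close> reads the old entry
  \<open>\<pi> (\<tau> k)\<close>; this produces the left composition with \<pi>.\<close>

lemma eta_perm_permute_samples:
  assumes "permute_samples n m \<pi> (x, y) = (x', y')" "\<tau> permutes {1..n+m}"
  shows "eta_perm h \<phi> l s n m x' y' t c \<tau> = eta_perm h \<phi> l s n m x y t c (\<pi> \<circ> \<tau>)"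
  unfolding eta_perm_def o_apply
proof (intro test_stat_cong)
  have \<tau>: "\<tau> k \<in> {1..n+m}" if "k \<in> {1..n+m}" for k
    using that permutes_in_image[OF assms(2)] by metis
  show "mixed_sample n m c x' y' i = mixed_sample n m c x y i" if "i \<in> {1..s}" for i
    using that by (intro mixed_sample_permute_samples[OF _ assms(1)]) simp
  show "pooled n x' y' (\<tau> i) = pooled n x y (\<pi> (\<tau> i))" if "i \<in> {1..n}" for i
    using that by (intro pooled_permute_samples[OF \<tau> assms(1)]) simp
  show "pooled n x' y' (\<tau> (n + j)) = pooled n x y (\<pi> (\<tau> (n + j)))" if "j \<in> {1..m}" for j
    using that by (intro pooled_permute_samples[OF \<tau> assms(1)]) simp
qed

lemma perm_quantile_permute_samples:
  assumes "permute_samples n m \<pi> (x, y) = (x', y')"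
    and "\<And>i. i \<in> {1..B} \<Longrightarrow> p i permutes {1..n+m}"
  shows "perm_quantile r B h \<phi> l s n m x' y' t c p
    = Inf {q. 1 / real B * (\<Sum>i\<in>{1..B}. of_bool (eta_perm h \<phi> l s n m x y t c (\<pi> \<circ> p i) \<le> q)) \<ge> r}"
proof -
  have "(\<Sum>i\<in>{1..B}. of_bool (eta_perm h \<phi> l s n m x' y' t c (p i) \<le> q) :: real)
      = (\<Sum>i\<in>{1..B}. of_bool (eta_perm h \<phi> l s n m x y t c (\<pi> \<circ> p i) \<le> q))" for q
    by (intro sum.cong refl) (simp only: eta_perm_permute_samples[OF assms])
  then show ?thesis unfolding perm_quantile_def by (simp only:)
qed

text \<open>Along the orbit of \<open>(x, y)\<close> the observed statistic is
  \<open>v \<pi>\<close> and its copies are \<open>v (\<pi> \<circ> p i)\<close> for one fixed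
  \<open>v\<close>, namely \<open>eta_perm\<close> at the original data. This is the setting of
  \<open>sum_permutation_test_le\<close>.\<close>

lemma sum_rejections_le:
  fixes x y :: "nat \<Rightarrow> 'x" and n m :: nat
  assumes "B > 0" "r \<le> 1" "1 + real B * (1 - r) \<le> \<beta> * (real B + 1)"
  defines "G \<equiv> {\<pi>. \<pi> permutes {1..n+m}}"
  shows "(\<Sum>\<pi>\<in>G. \<Sum>p\<in>{1..B} \<rightarrow>\<^sub>E G. case permute_samples n m \<pi> (x, y) of (x', y') \<Rightarrow>
      of_bool (perm_quantile r B h \<phi> l s n m x' y' t c p < eta_hat h \<phi> l s n m x' y' t c))
    \<le> \<beta> * real (card G) ^ (B + 1)" (is "?S \<le> _")
proof -
  let ?v = "eta_perm h \<phi> l s n m x y t c"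
  have "?S = (\<Sum>\<pi>\<in>G. \<Sum>p\<in>{1..B} \<rightarrow>\<^sub>E G.
      of_bool (Inf {q. 1 / real B * (\<Sum>i\<in>{1..B}. of_bool (?v (\<pi> \<circ> p i) \<le> q)) \<ge> r} < ?v \<pi>))"
  proof (intro sum.cong refl)
    fix \<pi> p assume p: "p \<in> {1..B} \<rightarrow>\<^sub>E G"
    obtain x' y' where xy: "permute_samples n m \<pi> (x, y) = (x', y')" by fastforce
    have perm: "p i permutes {1..n+m}" if "i \<in> {1..B}" for i
      using PiE_mem[OF p that] by (simp only: G_def mem_Collect_eq)
    show "(case permute_samples n m \<pi> (x, y) of (x', y') \<Rightarrow>
        of_bool (perm_quantile r B h \<phi> l s n m x' y' t c p < eta_hat h \<phi> l s n m x' y' t c))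
      = of_bool (Inf {q. 1 / real B * (\<Sum>i\<in>{1..B}. of_bool (?v (\<pi> \<circ> p i) \<le> q)) \<ge> r} < ?v \<pi>)"
      by (simp only: xy prod.case eta_hat_permute_samples[OF xy]
          perm_quantile_permute_samples[OF xy perm])
  qed
  then have "(real B + 1) * ?S \<le> (1 + real B * (1 - r)) * real (card G) ^ (B + 1)"
    unfolding G_def using assms(1,2) by (simp only: sum_permutation_test_le finite_atLeastAtMost)
  also have "\<dots> \<le> (\<beta> * (real B + 1)) * real (card G) ^ (B + 1)"
    using assms(3) by (intro mult_right_mono) auto
  also have "\<dots> = (real B + 1) * (\<beta> * real (card G) ^ (B + 1))" by simp
  finally show ?thesis by (subst (asm) mult_le_cancel_left_pos) auto
qed

section \<open>Level of the aggregated test\<close>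

theorem theorem11:
  fixes P Q :: "'x::second_countable_topology measure"
    and \<K> :: "('x \<Rightarrow> 'x \<Rightarrow> real) set"
    and T :: "('x \<Rightarrow> 'x \<Rightarrow> real) \<Rightarrow> 't topology"
    and \<Xi> :: "('x \<Rightarrow> 'x \<Rightarrow> real) \<Rightarrow> 't measure"
    and \<phi> :: "('x \<Rightarrow> 'x \<Rightarrow> real) \<Rightarrow> 'x \<Rightarrow> 't \<Rightarrow> real"
    and F :: "(('x \<Rightarrow> 'x \<Rightarrow> real) \<Rightarrow> nat \<Rightarrow> 't) measure"
    and g :: "real \<Rightarrow> real \<Rightarrow> real"
    and \<Lambda> :: "real set"
    and \<kappa> C\<^sub>1 C\<^sub>2 lam\<^sub>L \<alpha> w w' :: real
    and N M s l b B :: nat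
  assumes P: "prob_space P" "sets P = sets borel"
    and Q: "prob_space Q" "sets Q = sets borel"
    and finite_K: "finite \<K>"
    and A0: "\<And>K. K \<in> \<K> \<Longrightarrow> \<exists>H. is_rkhs H K"
      "\<And>K. K \<in> \<K> \<Longrightarrow> continuous_on UNIV (\<lambda>(x, y). K x y)"
      "\<And>K x. K \<in> \<K> \<Longrightarrow> K x x \<le> \<kappa>"
    and A1: "\<And>K. K \<in> \<K> \<Longrightarrow> second_countable (T K)"
      "\<And>K. K \<in> \<K> \<Longrightarrow> prob_space (\<Xi> K)"
      "\<And>K. K \<in> \<K> \<Longrightarrow> sets (\<Xi> K) = sets (borel_of (T K))"
      "\<And>K. K \<in> \<K> \<Longrightarrow>
         continuous_map (prod_topology euclidean (T K)) euclideanreal (\<lambda>(x, \<theta>). \<phi> K x \<theta>)"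
      "\<And>K x \<theta>. K \<in> \<K> \<Longrightarrow> \<theta> \<in> topspace (T K) \<Longrightarrow> \<bar>\<phi> K x \<theta>\<bar> \<le> sqrt \<kappa>"
      "\<And>K x y. K \<in> \<K> \<Longrightarrow> K x y = (LINT \<theta>|\<Xi> K. \<phi> K x \<theta> * \<phi> K y \<theta>)"
    and g_nonneg: "\<And>lam x. lam > 0 \<Longrightarrow> x \<ge> 0 \<Longrightarrow> g lam x \<ge> 0"
    and C: "C\<^sub>1 > 0" "C\<^sub>2 > 0"
    and A2: "\<And>lam x. lam > 0 \<Longrightarrow> x \<in> {0..\<kappa>} \<Longrightarrow> \<bar>x * g lam x\<bar> \<le> C\<^sub>1"
    and A3: "\<And>lam x. lam > 0 \<Longrightarrow> x \<in> {0..\<kappa>} \<Longrightarrow> \<bar>lam * g lam x\<bar> \<le> C\<^sub>2"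
    and sizes: "s \<ge> 2" "N - s \<ge> 2" "M - s \<ge> 2" "l \<ge> 1"
    and features: "feature_law \<K> \<Xi> l F"
    and Lambda: "lam\<^sub>L > 0" "\<Lambda> = (\<lambda>i. 2 ^ i * lam\<^sub>L) ` {0..b}"
    and alpha: "0 < \<alpha>" "\<alpha> \<le> 1"
    and w: "0 < w'" "w' < w" "w < 1/2"
    and B: "real B \<ge> (real (card \<Lambda>))\<^sup>2 * (real (card \<K>))\<^sup>2 / (2 * w'\<^sup>2 * \<alpha>\<^sup>2) *
              ln (2 * real (card \<Lambda>) * real (card \<K>) / (\<alpha> * (1 - w - w')))"
    and H0: "P = Q"
  shows "measure (sample_space P Q F N M s B)
    (\<Union>(lam, K) \<in> \<Lambda> \<times> \<K>. {(x, y, t, c, p) \<in> space (sample_space P Q F N M s B).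
       eta_hat (g lam) (\<phi> K) l s (N - s) (M - s) x y (t K) c
         > perm_quantile (1 - w * \<alpha> / (real (card \<Lambda>) * real (card \<K>))) B
             (g lam) (\<phi> K) l s (N - s) (M - s) x y (t K) c p}) \<le> \<alpha>"
proof -
  define n where "n = N - s"
  define m where "m = M - s"
  define L where "L = real (card \<Lambda>) * real (card \<K>)"
  define \<beta> where "\<beta> = \<alpha> / L"
  define r where "r = 1 - w * \<beta>"
  define G where "G = {\<pi>. \<pi> permutes {1..n+m}}"
  define S where "S = sample_space P Q F N M s B"
  define reject where "reject = (\<lambda>lam K x y t c p.
    perm_quantile r B (g lam) (\<phi> K) l s n m x y (t K) c p < eta_hat (g lam) (\<phi> K) l s n m x y (t K) c)"
  define E where "E = (\<Union>(lam, K)\<in>\<Lambda> \<times> \<K>. {(x, y, t, c, p) \<in> space S. reject lam K x y t c p})"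
  have goal: "(\<Union>(lam, K) \<in> \<Lambda> \<times> \<K>. {(x, y, t, c, p) \<in> space (sample_space P Q F N M s B).
       eta_hat (g lam) (\<phi> K) l s (N - s) (M - s) x y (t K) c
         > perm_quantile (1 - w * \<alpha> / (real (card \<Lambda>) * real (card \<K>))) B
             (g lam) (\<phi> K) l s (N - s) (M - s) x y (t K) c p}) = E"
    by (simp add: E_def reject_def S_def r_def \<beta>_def L_def n_def m_def)
  \<comment> \<open>Without kernels \<open>L\<close> is 0 and \<open>\<beta>\<close> a division by
    zero, but then the union is empty.\<close>
  consider "\<K> = {}" | "E \<notin> sets S" | "\<K> \<noteq> {}" "E \<in> sets S" by blast
  then have "measure S E \<le> \<alpha>"
  proof cases
    case 1
    then show ?thesis using alpha by (simp add: E_def)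
  next
    case 2
    then show ?thesis using alpha by (simp add: measure_notin_sets)
  next
    case 3
    have fin\<Lambda>: "finite \<Lambda>" and "\<Lambda> \<noteq> {}" by (auto simp: Lambda(2))
    then have "1 \<le> card \<Lambda>" "1 \<le> card \<K>"
      using 3(1) finite_K by (simp_all add: Suc_le_eq card_gt_0_iff)
    then have "1 * 1 \<le> L" unfolding L_def by (intro mult_mono) auto
    then have L: "1 \<le> L" by simp
    have \<beta>: "0 < \<beta>" "\<beta> \<le> 1" using alpha L by (auto simp: \<beta>_def)
    \<comment> \<open>Passing from \<alpha> to \<open>\<beta> = \<alpha> / L\<close> absorbs both
      cardinalities, so the assumption on \<open>B\<close> is the one for a single test of level
      \<beta>.\<close>
    have "L\<^sup>2 / (2 * w'\<^sup>2 * \<alpha>\<^sup>2) = 1 / (2 * w'\<^sup>2 * \<beta>\<^sup>2)" "2 * L / (\<alpha> * (1 - w - w')) = 2 / (\<beta> * (1 - w - w'))"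
      using L by (simp_all add: \<beta>_def power_divide)
    then have "1 / (2 * w'\<^sup>2 * \<beta>\<^sup>2) * ln (2 / (\<beta> * (1 - w - w'))) \<le> real B"
      using B by (simp add: L_def power_mult_distrib mult.assoc)
    from level_le_of_many_permutations[OF \<beta> w this]
    have B_pos: "B > 0" and level: "1 + real B * (1 - r) \<le> \<beta> * (real B + 1)"
      by (simp_all add: r_def)
    have r: "r \<le> 1" using \<beta> w by (simp add: r_def)
    have G: "finite G" "G \<noteq> {}"
      using finite_permutations[of "{1..n+m}"] permutes_id[of "{1..n+m}"] unfolding G_def by blast+
    then have card_G: "0 < real (card G)" by (simp add: card_gt_0_iff)

    let ?X = "\<Pi>\<^sub>M i\<in>{1..N}. P" and ?Y = "\<Pi>\<^sub>M i\<in>{1..M}. P"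
    let ?C = "\<Pi>\<^sub>M i\<in>{1..s}. measure_pmf (bernoulli_pmf (1/2))"
    let ?\<Pi> = "\<Pi>\<^sub>M i\<in>{1..B}. measure_pmf (pmf_of_set G)"
    \<comment> \<open>The null hypothesis enters here: both samples are drawn from
      \<open>P\<close>.\<close>
    have S: "S = ?X \<Otimes>\<^sub>M ?Y \<Otimes>\<^sub>M F \<Otimes>\<^sub>M ?C \<Otimes>\<^sub>M ?\<Pi>"
      by (simp add: S_def sample_space_def H0 G_def n_def m_def)
    have prob: "prob_space ?X" "prob_space ?Y" "prob_space F" "prob_space ?C" "prob_space ?\<Pi>"
      using P(1) features by (auto simp: feature_law_def intro!: prob_space_PiM prob_space_measure_pmf)
    have "emeasure S E = (\<integral>\<^sup>+\<omega>. indicator E \<omega> \<partial>S)"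
      using 3(2) by simp
    also have "\<dots> \<le> ennreal \<alpha>"
      unfolding S
    proof (rule nn_integral_pair_invariant_average[where G = G and S = "permute_samples n m", OF prob G])
      fix \<pi> assume "\<pi> \<in> G"
      then have \<pi>: "\<pi> permutes {1..n+m}" by (simp add: G_def)
      have "n \<le> N" "m \<le> M" by (simp_all add: n_def m_def)
      from permute_samples_invariant[OF P(1) \<pi> this]
      show "permute_samples n m \<pi> \<in> measurable (?X \<Otimes>\<^sub>M ?Y) (?X \<Otimes>\<^sub>M ?Y)"
        "distr (?X \<Otimes>\<^sub>M ?Y) (?X \<Otimes>\<^sub>M ?Y) (permute_samples n m \<pi>) = ?X \<Otimes>\<^sub>M ?Y" by simp_all
    next
      show "indicator E \<in> borel_measurable (?X \<Otimes>\<^sub>M ?Y \<Otimes>\<^sub>M F \<Otimes>\<^sub>M ?C \<Otimes>\<^sub>M ?\<Pi>)"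
        using 3(2) unfolding S by (rule borel_measurable_indicator)
    next
      fix x y t c
      let ?\<Omega> = "{1..B} \<rightarrow>\<^sub>E G"
      define R where "R = (\<lambda>lam K \<pi> p. case permute_samples n m \<pi> (x, y) of (x', y') \<Rightarrow>
        (of_bool (reject lam K x' y' t c p) :: real))"
      let ?E = "\<lambda>\<pi> p. (fst (permute_samples n m \<pi> (x, y)), snd (permute_samples n m \<pi> (x, y)), t, c, p)"
      \<comment> \<open>The mass of each single \<open>B\<close>-tuple of permutations.\<close>
      let ?q = "1 / real (card G) ^ B"
      \<comment> \<open>The union bound in pointwise form: the indicator of the union is at most the
        sum of the single rejection indicators at the permuted data.\<close>
      have bound: "indicator E (?E \<pi> p) \<le> (\<Sum>(lam, K)\<in>\<Lambda> \<times> \<K>. R lam K \<pi> p)" for \<pi> p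
      proof (cases "?E \<pi> p \<in> E")
        case True
        then obtain lam K where *: "(lam, K) \<in> \<Lambda> \<times> \<K>" "R lam K \<pi> p = 1"
          by (auto simp: E_def R_def split_beta)
        have "R lam K \<pi> p \<le> (\<Sum>(lam, K)\<in>\<Lambda> \<times> \<K>. R lam K \<pi> p)"
          using member_le_sum[of "(lam, K)" "\<Lambda> \<times> \<K>" "\<lambda>(lam, K). R lam K \<pi> p"]
            *(1) fin\<Lambda> finite_K by (simp add: R_def split_beta)
        then show ?thesis using True *(2) by simp
      next
        case False
        then show ?thesis by (auto simp: R_def intro!: sum_nonneg split: prod.splits)
      qed
      have "(\<Sum>\<pi>\<in>G. \<Sum>p\<in>?\<Omega>. indicator E (?E \<pi> p) * ?q)
          \<le> (\<Sum>\<pi>\<in>G. \<Sum>p\<in>?\<Omega>. (\<Sum>(lam, K)\<in>\<Lambda> \<times> \<K>. R lam K \<pi> p) * ?q)"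
        by (intro sum_mono mult_right_mono bound) simp
      also have "\<dots> = (\<Sum>(lam, K)\<in>\<Lambda> \<times> \<K>. \<Sum>\<pi>\<in>G. \<Sum>p\<in>?\<Omega>. R lam K \<pi> p) * ?q"
        by (simp only: split_beta sum_distrib_right sum.swap[of _ ?\<Omega> "\<Lambda> \<times> \<K>"] sum.swap[of _ G "\<Lambda> \<times> \<K>"])
      \<comment> \<open>Each pair contributes \<open>\<beta> * card G\<close> once multiplied by
        \<open>?q\<close>, and the \<open>L\<close> pairs together give \<alpha> because
        \<open>L * \<beta> = \<alpha>\<close>.\<close>
      also have "\<dots> \<le> (\<Sum>(lam, K)\<in>\<Lambda> \<times> \<K>. \<beta> * real (card G) ^ (B + 1)) * ?q"
        unfolding R_def reject_def G_def split_beta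
        by (intro mult_right_mono sum_mono sum_rejections_le[unfolded split_beta] B_pos r level) simp
      also have "\<dots> = \<alpha> * card G"
        using \<open>1 \<le> card \<Lambda>\<close> \<open>1 \<le> card \<K>\<close> card_G by (simp add: card_cartesian_product \<beta>_def L_def)
      finally have le: "(\<Sum>\<pi>\<in>G. \<Sum>p\<in>?\<Omega>. indicator E (?E \<pi> p) * ?q) \<le> \<alpha> * card G" .
      have "(\<Sum>\<pi>\<in>G. \<integral>\<^sup>+p. indicator E (?E \<pi> p) \<partial>?\<Pi>)
          = (\<Sum>\<pi>\<in>G. \<Sum>p\<in>?\<Omega>. indicator E (?E \<pi> p) * ennreal ?q)"
        using nn_integral_PiM_pmf_of_set[of "{1..B}" G] G by simp
      also have "\<dots> = ennreal (\<Sum>\<pi>\<in>G. \<Sum>p\<in>?\<Omega>. indicator E (?E \<pi> p) * ?q)"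
        by (simp add: sum_nonneg flip: ennreal_indicator ennreal_mult)
      also have "\<dots> \<le> ennreal (\<alpha> * card G)"
        using le by (rule ennreal_leI)
      also have "\<dots> = ennreal \<alpha> * of_nat (card G)"
        using alpha by (simp add: ennreal_mult ennreal_of_nat_eq_real_of_nat)
      finally show "(\<Sum>\<pi>\<in>G. \<integral>\<^sup>+p. indicator E (?E \<pi> p) \<partial>?\<Pi>) \<le> ennreal \<alpha> * of_nat (card G)" .
    qed
    finally show ?thesis
      using alpha by (simp add: measure_def enn2real_leI)
  qed
  then show ?thesis unfolding goal S_def .
qed

end
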